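(* Let $T>0$, $K>0$. For every $u_0\in C([-1,0])$ the mapping $$\mathfrak m_T\ni\mu\mapsto z(\cdot;\mu,u_0)\in C([-1,T])$$ is sequentially continuous: if $\mu^{(n)},\mu\in\mathfrak m_T$ and $\mu^{(n)}\to\mu$, then $z(\cdot;\mu^{(n)},u_0)\to z(\cdot;\mu,u_0)$ in the supremum norm of $C([-1,T])$.
   Context: Let $\mathfrak m$ be the set of finite signed Borel measures $\nu$ on $[-1,0]$ with $\|\nu\|_{\mathrm{TV}}\le K$. $\mathfrak m_T$ is the set of all maps $\mu:[0,T]\to\mathfrak m$, $t\mapsto\mu_t$, such that for every $f\in C([-1,0])$ the function $t\mapsto\int_{[-1,0]}f\,d\mu_t$ is Lebesgue measurable on $[0,T]$. Convergence $\mu^{(n)}\to\mu$ in $\mathfrak m_T$ means: for Lebesgue-almost every $t\in[0,T]$, $\int f\,d\mu^{(n)}_t\to\int f\,d\mu_t$ for every $f\in C([-1,0])$ (weak-* convergence almost everywhere). For $\mu\in\mathfrak m_T$, $u_0\in C([-1,0])$, $z(\cdot;\mu,u_0)\in C([-1,T])$ denotes the unique continuous function with $z=u_0$ on $[-1,0]$ and $z(t)=u_0(0)+\int_0^t\int_{[-1,0]}z(\tau+s)\,d\mu_\tau(s)\,d\tau$ for $t\in[0,T]$. *)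

theory Defs
  imports "HOL-Analysis.Analysis"
begin

text \<open>Finite signed measures on the sigma-algebra of \<open>M\<close>, as set functions; the measure
  of \<open>M\<close> itself plays no role.  The last clause only makes set functions that agree
  on \<open>sets M\<close> equal.\<close>

definition signed_measure :: "'a measure \<Rightarrow> ('a set \<Rightarrow> real) \<Rightarrow> bool" where
  "signed_measure M \<nu> \<longleftrightarrow>
     \<nu> {} = 0 \<and>
     (\<forall>A :: nat \<Rightarrow> 'a set. range A \<subseteq> sets M \<longrightarrow> disjoint_family A \<longrightarrow>
        (\<lambda>i. \<nu> (A i)) sums \<nu> (\<Union>i. A i)) \<and>
     (\<forall>A. A \<notin> sets M \<longrightarrow> \<nu> A = 0)"

definition tv_norm :: "'a measure \<Rightarrow> ('a set \<Rightarrow> real) \<Rightarrow> ennreal" where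
  "tv_norm M \<nu> =
     (SUP P \<in> {P. finite P \<and> P \<subseteq> sets M \<and> partition_on (space M) P}.
        \<Sum>A\<in>P. ennreal \<bar>\<nu> A\<bar>)"

text \<open>The positive part of the Jordan decomposition, \<open>A \<mapsto> sup {\<nu> B | B \<subseteq> A}\<close>.  Since \<open>ennreal\<close>
  truncates negative numbers to 0 and \<open>\<nu> {} = 0\<close>, the truncation does not change the
  supremum.  The negative part of \<open>\<nu>\<close> is the positive part of \<open>- \<nu>\<close>.\<close>

definition pos_part :: "'a measure \<Rightarrow> ('a set \<Rightarrow> real) \<Rightarrow> 'a measure" where
  "pos_part M \<nu> =
     measure_of (space M) (sets M) (\<lambda>A. SUP B \<in> {B \<in> sets M. B \<subseteq> A}. ennreal (\<nu> B))"

definition signed_integral :: "'a measure \<Rightarrow> ('a set \<Rightarrow> real) \<Rightarrow> ('a \<Rightarrow> real) \<Rightarrow> real" where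
  "signed_integral M \<nu> f =
     (\<integral>x. f x \<partial>pos_part M \<nu>) - (\<integral>x. f x \<partial>pos_part M (\<lambda>A. - \<nu> A))"

abbreviation delay_borel :: "real measure" where
  "delay_borel \<equiv> restrict_space borel {-1..0}"

definition delay_measures :: "real \<Rightarrow> (real set \<Rightarrow> real) set" where
  "delay_measures K = {\<nu>. signed_measure delay_borel \<nu> \<and> tv_norm delay_borel \<nu> \<le> ennreal K}"

definition delay_measure_maps :: "real \<Rightarrow> real \<Rightarrow> (real \<Rightarrow> real set \<Rightarrow> real) set" where
  "delay_measure_maps K T =
     {\<mu>. \<mu> \<in> {0..T} \<rightarrow> delay_measures K \<and>
         (\<forall>f. continuous_on {-1..0} f \<longrightarrow>
            (\<lambda>t. signed_integral delay_borel (\<mu> t) f) \<in> borel_measurable (lebesgue_on {0..T}))}"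

text \<open>Weak-* convergence almost everywhere; the exceptional null set does not depend on
  the test function.\<close>

definition converges_weak_star_ae ::
    "real \<Rightarrow> (nat \<Rightarrow> real \<Rightarrow> real set \<Rightarrow> real) \<Rightarrow> (real \<Rightarrow> real set \<Rightarrow> real) \<Rightarrow> bool" where
  "converges_weak_star_ae T \<mu>n \<mu> \<longleftrightarrow>
     (AE t in lebesgue_on {0..T}. \<forall>f. continuous_on {-1..0} f \<longrightarrow>
        (\<lambda>n. signed_integral delay_borel (\<mu>n n t) f)
          \<longlonglongrightarrow> signed_integral delay_borel (\<mu> t) f)"

definition is_delay_solution ::
    "real \<Rightarrow> (real \<Rightarrow> real set \<Rightarrow> real) \<Rightarrow> (real \<Rightarrow> real) \<Rightarrow> (real \<Rightarrow> real) \<Rightarrow> bool" where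
  "is_delay_solution T \<mu> u\<^sub>0 z \<longleftrightarrow>
     continuous_on {-1..T} z \<and>
     (\<forall>t\<in>{-1..0}. z t = u\<^sub>0 t) \<and>
     (\<forall>t\<in>{0..T}. z t = u\<^sub>0 0 +
        (LINT \<tau>:{0..t}|lebesgue. signed_integral delay_borel (\<mu> \<tau>) (\<lambda>s. z (\<tau> + s))))"

text \<open>An element of \<open>C([-1,T])\<close> is represented by a function that is \<open>undefined\<close> outside
  \<open>[-1,T]\<close>, so that the solution is unique as a HOL function.\<close>

definition delay_solution ::
    "real \<Rightarrow> (real \<Rightarrow> real set \<Rightarrow> real) \<Rightarrow> (real \<Rightarrow> real) \<Rightarrow> real \<Rightarrow> real" where
  "delay_solution T \<mu> u\<^sub>0 =
     (THE z. z \<in> extensional {-1..T} \<and> is_delay_solution T \<mu> u\<^sub>0 z)"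

definition sup_norm_on :: "'a set \<Rightarrow> ('a \<Rightarrow> real) \<Rightarrow> real" where
  "sup_norm_on S f = (SUP x\<in>S. \<bar>f x\<bar>)"

end

theory Submission
  imports Defs
begin

text \<open>The right-hand side of the equation at time \<open>\<tau>\<close> is the linear functional
  \<open>delay_term\<close>, the integral of the segment \<open>s \<mapsto> z (\<tau> + s)\<close> against \<open>\<mu> \<tau>\<close>. Since the total
  variation of \<open>\<mu> \<tau>\<close> is at most \<open>K\<close>, the functional is bounded by \<open>K\<close> times the maximum of \<open>\<bar>z\<bar>\<close>
  on \<open>[\<tau> - 1, \<tau>]\<close> (\<open>abs_delay_term_le\<close>), and it is measurable in \<open>\<tau>\<close>
  (\<open>borel_measurable_delay_term\<close>).

  As the equation only looks backwards in time, a function bounded by \<open>M exp (2 K x)\<close> has a delay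
  term bounded by \<open>K M exp (2 K \<tau>)\<close>, whose integral from \<open>0\<close> to \<open>t\<close> is below
  \<open>(M / 2) exp (2 K t)\<close>. So integration of the delay term halves the sup norm with weight
  \<open>exp (- 2 K x)\<close> (\<open>abs_integral_delay_term_le_weighted\<close>). This one estimate makes the Picard
  operator a contraction, which gives existence (\<open>delay_solution_exists\<close>), and it yields an
  inequality of Gronwall type (\<open>delay_gronwall\<close>), which gives uniqueness and stability.

  For the continuity, let \<open>z\<close> solve the equation for \<open>\<mu>\<close> and \<open>w\<close> the one for \<open>\<nu>\<close>. The difference
  \<open>w - z\<close> satisfies the equation for \<open>\<nu>\<close> up to an error that is at most the \<open>L\<^sup>1\<close> distance of the
  delay terms of \<open>\<nu>\<close> and \<open>\<mu>\<close> along the fixed trajectory \<open>z\<close>; by the Gronwall inequality this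
  distance controls \<open>w - z\<close> uniformly (\<open>delay_solution_stability\<close>). For \<open>\<nu> = \<mu>n n\<close> the delay terms
  along \<open>z\<close> converge almost everywhere, because each segment of \<open>z\<close> is a continuous test function,
  and they are uniformly bounded. Dominated convergence finishes the proof
  (\<open>delay_term_L1_convergence\<close>).\<close>

section \<open>Signed integrals against measures of bounded variation\<close>

lemma signed_measure_disjoint_Un:
  assumes "signed_measure M \<nu>" "A \<in> sets M" "B \<in> sets M" "A \<inter> B = {}"
  shows "\<nu> (A \<union> B) = \<nu> A + \<nu> B"
proof -
  have "range (binaryset A B) \<subseteq> sets M"
    using assms by (auto simp: range_binaryset_eq)
  moreover have "disjoint_family (binaryset A B)"
    using assms by (auto simp: disjoint_family_on_def binaryset_def)
  ultimately have "(\<lambda>i. \<nu> (binaryset A B i)) sums \<nu> (A \<union> B)"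
    using assms(1) unfolding signed_measure_def UN_binaryset_eq[symmetric] by blast
  moreover have "(\<lambda>i. \<nu> (binaryset A B i)) sums (\<nu> A + \<nu> B)"
    using assms(1) by (intro binaryset_sums) (simp add: signed_measure_def)
  ultimately show ?thesis by (rule sums_unique2)
qed

text \<open>The two sets together with the complement of their union form a partition, apart from
  empty blocks, which contribute nothing.\<close>

lemma disjoint_pair_le_tv_norm:
  assumes \<nu>: "\<nu> {} = 0" and A: "A \<in> sets M" "B \<in> sets M" "A \<inter> B = {}"
  shows "ennreal \<bar>\<nu> A\<bar> + ennreal \<bar>\<nu> B\<bar> \<le> tv_norm M \<nu>"
proof -
  let ?Q = "{A, B, space M - (A \<union> B)}"
  let ?P = "?Q - {{}}"
  have "A \<subseteq> space M" "B \<subseteq> space M" using A(1,2) by (simp_all add: sets.sets_into_space)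
  then have P: "?P \<in> {P. finite P \<and> P \<subseteq> sets M \<and> partition_on (space M) P}"
  proof (intro CollectI conjI)
    have "pairwise disjnt ?Q"
      unfolding pairwise_insert disjnt_def using A(3) by auto
    then have "pairwise disjnt ?P" by (rule pairwise_subset) simp
    moreover have "\<Union> ?P = space M"
    proof -
      have "\<Union> (\<Q> - {{}}) = \<Union> \<Q>" for \<Q> :: "'a set set" by blast
      then have "\<Union> ?P = A \<union> B \<union> (space M - (A \<union> B))"
        by (simp only: Union_insert Union_empty Un_empty_right Un_assoc)
      then show ?thesis
        using Un_least[OF \<open>A \<subseteq> space M\<close> \<open>B \<subseteq> space M\<close>]
        by (simp only: Un_Diff_cancel Un_absorb1)
    qed
    ultimately show "partition_on (space M) ?P"
      by (simp add: partition_on_def)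
    have "?Q \<subseteq> sets M" using A(1,2) by simp
    then show "?P \<subseteq> sets M" by (rule subset_trans[OF Diff_subset])
  qed simp
  have "ennreal \<bar>\<nu> A\<bar> + ennreal \<bar>\<nu> B\<bar> = (\<Sum>X\<in>{A, B}. ennreal \<bar>\<nu> X\<bar>)"
    using A \<nu> by (cases "A = B") auto
  also have "\<dots> \<le> (\<Sum>X\<in>?Q. ennreal \<bar>\<nu> X\<bar>)"
    by (intro sum_mono2) auto
  also have "\<dots> = (\<Sum>X\<in>?P. ennreal \<bar>\<nu> X\<bar>)"
    using \<nu> by (intro sum.mono_neutral_right) auto
  also have "\<dots> \<le> tv_norm M \<nu>"
    unfolding tv_norm_def using P by (rule SUP_upper)
  finally show ?thesis .
qed

text \<open>The intersection of \<open>A\<close> and \<open>B\<close> cancels in \<open>\<nu> A - \<nu> B\<close>, which leaves the disjoint pair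
  \<open>A - B\<close> and \<open>B - A\<close>.\<close>

lemma upper_minus_lower_le_tv_norm:
  assumes \<nu>: "signed_measure M \<nu>" and A: "A \<in> sets M" "B \<in> sets M"
  shows "ennreal (\<nu> A) + ennreal (- \<nu> B) \<le> tv_norm M \<nu>"
proof -
  have \<nu>0: "\<nu> {} = 0" using \<nu> by (simp add: signed_measure_def)
  \<comment> \<open>The coercion to \<open>ennreal\<close> truncates negative values to \<open>0 = \<nu> {}\<close>, so a set that would be
    truncated can be replaced by the empty set.\<close>
  define A' where "A' = (if \<nu> A < 0 then {} else A)"
  define B' where "B' = (if \<nu> B > 0 then {} else B)"
  have A': "A' \<in> sets M" "B' \<in> sets M" using A by (auto simp: A'_def B'_def)
  have pos: "0 \<le> \<nu> A'" "0 \<le> - \<nu> B'" by (auto simp: A'_def B'_def \<nu>0)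
  have split_by: "\<nu> X = \<nu> (X - Y) + \<nu> (X \<inter> Y)" if "X \<in> sets M" "Y \<in> sets M" for X Y
  proof -
    have "X - Y \<union> X \<inter> Y = X" "(X - Y) \<inter> (X \<inter> Y) = {}" by blast+
    then show ?thesis
      using signed_measure_disjoint_Un[OF \<nu>, of "X - Y" "X \<inter> Y"] that by simp
  qed
  have "\<nu> A' = \<nu> (A' - B') + \<nu> (A' \<inter> B')"
    using split_by[of A' B'] A' by blast
  moreover have "\<nu> B' = \<nu> (B' - A') + \<nu> (A' \<inter> B')"
    using split_by[of B' A'] A' by (simp add: Int_commute)
  ultimately have le: "\<nu> A' + - \<nu> B' \<le> \<bar>\<nu> (A' - B')\<bar> + \<bar>\<nu> (B' - A')\<bar>" by linarith
  have "ennreal (\<nu> A) + ennreal (- \<nu> B) = ennreal (\<nu> A') + ennreal (- \<nu> B')"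
    by (auto simp: A'_def B'_def \<nu>0 ennreal_neg)
  also have "\<dots> = ennreal (\<nu> A' + - \<nu> B')" using pos by (rule ennreal_plus[symmetric])
  also have "\<dots> \<le> ennreal (\<bar>\<nu> (A' - B')\<bar> + \<bar>\<nu> (B' - A')\<bar>)" using le by (rule ennreal_leI)
  also have "\<dots> = ennreal \<bar>\<nu> (A' - B')\<bar> + ennreal \<bar>\<nu> (B' - A')\<bar>" by simp
  also have "\<dots> \<le> tv_norm M \<nu>" using A' \<nu>0 by (intro disjoint_pair_le_tv_norm) auto
  finally show ?thesis .
qed

lemma sets_pos_part [measurable_cong, simp]: "sets (pos_part M \<nu>) = sets M"
  by (simp add: pos_part_def)

lemma space_pos_part [simp]: "space (pos_part M \<nu>) = space M"
  by (simp add: pos_part_def)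

text \<open>The measure built by \<open>measure_of\<close> is zero whenever its set function fails to be a measure, so the
  upper bound is available for every set function \<open>\<nu>\<close>.\<close>

lemma emeasure_pos_part_le:
  "emeasure (pos_part M \<nu>) A \<le> (SUP B \<in> {B \<in> sets M. B \<subseteq> A}. ennreal (\<nu> B))"
  unfolding pos_part_def emeasure_measure_of_conv by auto

lemma jordan_mass_le_tv_norm:
  assumes \<nu>: "signed_measure M \<nu>"
  shows "emeasure (pos_part M \<nu>) (space M) + emeasure (pos_part M (\<lambda>A. - \<nu> A)) (space M)
           \<le> tv_norm M \<nu>"
proof -
  let ?S = "{B \<in> sets M. B \<subseteq> space M}"
  have ne: "?S \<noteq> {}" by auto
  have "emeasure (pos_part M \<nu>) (space M) + emeasure (pos_part M (\<lambda>A. - \<nu> A)) (space M)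
      \<le> (SUP A\<in>?S. ennreal (\<nu> A)) + (SUP B\<in>?S. ennreal (- \<nu> B))"
    by (intro add_mono emeasure_pos_part_le)
  also have "\<dots> = (SUP A\<in>?S. SUP B\<in>?S. ennreal (\<nu> A) + ennreal (- \<nu> B))"
    unfolding ennreal_SUP_add_right[OF ne, symmetric] ennreal_SUP_add_left[OF ne] ..
  also have "\<dots> \<le> tv_norm M \<nu>"
    by (intro SUP_least upper_minus_lower_le_tv_norm[OF \<nu>]) simp_all
  finally show ?thesis .
qed

text \<open>Since the two parts share the mass \<open>K\<close>, integration of \<open>f\<close> against their difference costs only
  a factor \<open>K\<close>, not \<open>2 K\<close>.\<close>

lemma delay_measure_masses:
  assumes "\<nu> \<in> delay_measures K" "0 \<le> K"
  shows "finite_measure (pos_part delay_borel \<nu>)"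
    and "finite_measure (pos_part delay_borel (\<lambda>A. - \<nu> A))"
    and "measure (pos_part delay_borel \<nu>) {-1..0}
           + measure (pos_part delay_borel (\<lambda>A. - \<nu> A)) {-1..0} \<le> K"
proof -
  let ?p = "pos_part delay_borel \<nu>" and ?q = "pos_part delay_borel (\<lambda>A. - \<nu> A)"
  have le: "emeasure ?p {-1..0} + emeasure ?q {-1..0} \<le> ennreal K"
    using jordan_mass_le_tv_norm[of delay_borel \<nu>] assms
    by (auto simp: delay_measures_def space_restrict_space)
  then have "emeasure ?p {-1..0} + emeasure ?q {-1..0} < \<infinity>"
    by (rule le_less_trans) simp
  then have fin: "emeasure ?p {-1..0} < \<infinity>" "emeasure ?q {-1..0} < \<infinity>"
    by simp_all
  then show "finite_measure ?p" "finite_measure ?q"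
    by (auto intro!: finite_measureI simp: space_restrict_space)
  have "ennreal (measure ?p {-1..0} + measure ?q {-1..0}) \<le> ennreal K"
    using le fin by (simp add: emeasure_eq_ennreal_measure)
  then show "measure ?p {-1..0} + measure ?q {-1..0} \<le> K"
    using assms(2) ennreal_le_iff by blast
qed

lemma continuous_on_Icc_abs_bounded:
  fixes f :: "real \<Rightarrow> real"
  assumes "continuous_on {a..b} f"
  shows "\<exists>C. \<forall>x\<in>{a..b}. \<bar>f x\<bar> \<le> C"
proof -
  have "bounded (f ` {a..b})"
    using compact_continuous_image[OF assms compact_Icc] by (rule compact_imp_bounded)
  then show ?thesis unfolding bounded_iff by auto
qed

lemma integrable_pos_part_continuous:
  fixes f :: "real \<Rightarrow> real"
  assumes "finite_measure (pos_part delay_borel \<nu>)" "continuous_on {-1..0} f"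
  shows "integrable (pos_part delay_borel \<nu>) f"
proof -
  obtain C where C: "\<And>x. x \<in> {-1..0} \<Longrightarrow> \<bar>f x\<bar> \<le> C"
    using continuous_on_Icc_abs_bounded[OF assms(2)] by blast
  have "f \<in> borel_measurable delay_borel"
    using assms(2) by (rule borel_measurable_continuous_on_restrict)
  then show ?thesis
    using C assms(1)
    by (intro finite_measure.integrable_const_bound[where B = C])
       (auto simp: space_restrict_space intro!: AE_I2 cong: measurable_cong_sets)
qed

lemma signed_integral_cong:
  assumes "\<And>s. s \<in> {-1..0} \<Longrightarrow> f s = g s"
  shows "signed_integral delay_borel \<nu> f = signed_integral delay_borel \<nu> g"
  unfolding signed_integral_def using assms
  by (intro arg_cong2[where f = "(-)"] Bochner_Integration.integral_cong)
     (auto simp: space_restrict_space)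

lemma signed_integral_diff:
  assumes "\<nu> \<in> delay_measures K" "0 \<le> K" "continuous_on {-1..0} f" "continuous_on {-1..0} g"
  shows "signed_integral delay_borel \<nu> (\<lambda>s. f s - g s)
           = signed_integral delay_borel \<nu> f - signed_integral delay_borel \<nu> g"
  using delay_measure_masses[OF assms(1,2)] assms(3,4)
  by (simp add: signed_integral_def integrable_pos_part_continuous)

lemma abs_signed_integral_le:
  assumes \<nu>: "\<nu> \<in> delay_measures K" "0 \<le> K" and f: "continuous_on {-1..0} f"
    and C: "\<And>s. s \<in> {-1..0} \<Longrightarrow> \<bar>f s\<bar> \<le> C"
  shows "\<bar>signed_integral delay_borel \<nu> f\<bar> \<le> K * C"
proof -
  let ?p = "pos_part delay_borel \<nu>" and ?q = "pos_part delay_borel (\<lambda>A. - \<nu> A)"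
  note fin = delay_measure_masses[OF \<nu>]
  have *: "\<bar>integral\<^sup>L (pos_part delay_borel \<kappa>) f\<bar> \<le> C * measure (pos_part delay_borel \<kappa>) {-1..0}"
    if \<kappa>: "finite_measure (pos_part delay_borel \<kappa>)" for \<kappa>
  proof -
    interpret finite_measure "pos_part delay_borel \<kappa>" by fact
    have "\<bar>integral\<^sup>L (pos_part delay_borel \<kappa>) f\<bar> \<le> (\<integral>x. \<bar>f x\<bar> \<partial>pos_part delay_borel \<kappa>)"
      by (rule integral_abs_bound)
    also have "\<dots> \<le> (\<integral>x. C \<partial>pos_part delay_borel \<kappa>)"
      using \<kappa> f C
      by (intro integral_mono integrable_abs integrable_pos_part_continuous)
         (auto simp: space_restrict_space)
    finally show ?thesis by (simp add: space_restrict_space mult.commute)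
  qed
  have "0 \<le> C" using C[of 0] by simp
  have "\<bar>signed_integral delay_borel \<nu> f\<bar> \<le> C * measure ?p {-1..0} + C * measure ?q {-1..0}"
    using *[OF fin(1)] *[OF fin(2)] unfolding signed_integral_def by linarith
  also have "\<dots> \<le> C * K"
    using fin(3) \<open>0 \<le> C\<close> by (metis distrib_left mult_left_mono)
  finally show ?thesis by (simp add: mult.commute)
qed

section \<open>The delay term along a trajectory\<close>

definition delay_term :: "(real \<Rightarrow> real set \<Rightarrow> real) \<Rightarrow> (real \<Rightarrow> real) \<Rightarrow> real \<Rightarrow> real" where
  "delay_term \<mu> z \<tau> = signed_integral delay_borel (\<mu> \<tau>) (\<lambda>s. z (\<tau> + s))"

lemma continuous_on_segment:
  fixes z :: "real \<Rightarrow> real"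
  assumes "continuous_on {-1..T} z" "\<tau> \<in> {0..T}"
  shows "continuous_on {-1..0} (\<lambda>s. z (\<tau> + s))"
  using assms(2) by (intro continuous_on_compose2[OF assms(1)] continuous_intros) auto

lemma delay_term_diff:
  assumes "\<mu> \<in> delay_measure_maps K T" "0 \<le> K" "\<tau> \<in> {0..T}"
    and "continuous_on {-1..T} z" "continuous_on {-1..T} w"
  shows "delay_term \<mu> (\<lambda>x. z x - w x) \<tau> = delay_term \<mu> z \<tau> - delay_term \<mu> w \<tau>"
  unfolding delay_term_def
  using assms by (intro signed_integral_diff[of _ K] continuous_on_segment)
     (auto simp: delay_measure_maps_def)

lemma abs_delay_term_le:
  assumes "\<mu> \<in> delay_measure_maps K T" "0 \<le> K" "\<tau> \<in> {0..T}" "continuous_on {-1..T} z"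
    and "\<And>x. x \<in> {\<tau> - 1..\<tau>} \<Longrightarrow> \<bar>z x\<bar> \<le> C"
  shows "\<bar>delay_term \<mu> z \<tau>\<bar> \<le> K * C"
  unfolding delay_term_def
  using assms by (intro abs_signed_integral_le continuous_on_segment)
     (auto simp: delay_measure_maps_def)

text \<open>Both the measure and the segment of \<open>z\<close> move with \<open>\<tau>\<close>, whereas the measurability of \<open>\<mu>\<close> concerns
  a fixed test function. Hence the segment is sampled at grid points: rounding \<open>\<tau>\<close> down to a multiple
  of \<open>1 / (n + 1)\<close> leaves countably many test functions, and uniform continuity of \<open>z\<close> with the
  bound \<open>K\<close> on the measures makes these approximations converge pointwise.\<close>

lemma borel_measurable_delay_term:
  assumes \<mu>: "\<mu> \<in> delay_measure_maps K T" and K: "0 \<le> K" and z: "continuous_on {-1..T} z"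
  shows "delay_term \<mu> z \<in> borel_measurable (lebesgue_on {0..T})"
proof -
  define grid :: "nat \<Rightarrow> int \<Rightarrow> real" where "grid n k = of_int k / real (Suc n)" for n k
  define step where "step n \<tau> = \<lfloor>real (Suc n) * \<tau>\<rfloor>" for n and \<tau> :: real
  \<comment> \<open>Rounding down keeps the grid point in \<open>[0,T]\<close> for every \<open>\<tau>\<close> in \<open>[0,T]\<close>; the other grid
    points receive the value \<open>0\<close>, so that the function is measurable for every integer \<open>k\<close>.\<close>
  define sampled where "sampled n k \<tau> =
      (if grid n k \<in> {0..T} then signed_integral delay_borel (\<mu> \<tau>) (\<lambda>s. z (grid n k + s)) else 0)"
    for n k and \<tau> :: real
  have "sampled n k \<in> borel_measurable (lebesgue_on {0..T})" for n k
  proof (cases "grid n k \<in> {0..T}")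
    case True
    then show ?thesis
      using \<mu> continuous_on_segment[OF z True]
      by (simp add: sampled_def[abs_def] delay_measure_maps_def)
  next
    case False
    then have "sampled n k = (\<lambda>_. 0)" by (auto simp only: sampled_def if_False)
    then show ?thesis by simp
  qed
  moreover have "step n \<in> lebesgue_on {0..T} \<rightarrow>\<^sub>M count_space UNIV" for n
  proof -
    have "(\<lambda>\<tau>::real. real (Suc n) * \<tau>) \<in> borel_measurable (lebesgue_on {0..T})"
      by (intro borel_measurable_times borel_measurable_const measurable_restrict_space1
          measurable_completion) simp
    then show ?thesis unfolding step_def by (rule measurable_compose) simp
  qed
  ultimately have meas: "(\<lambda>\<tau>. sampled n (step n \<tau>) \<tau>) \<in> borel_measurable (lebesgue_on {0..T})" for n
    by (rule measurable_compose_countable)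
  have lim: "(\<lambda>n. sampled n (step n \<tau>) \<tau>) \<longlonglongrightarrow> delay_term \<mu> z \<tau>" if \<tau>: "\<tau> \<in> {0..T}" for \<tau>
  proof (rule LIMSEQ_I)
    fix e :: real assume e: "e > 0"
    have "uniformly_continuous_on {-1..T} z"
      using z by (intro compact_uniformly_continuous) auto
    \<comment> \<open>The tolerance \<open>e / (K + 1)\<close> keeps the final bound \<open>K e / (K + 1)\<close> strictly below \<open>e\<close>.\<close>
    then obtain d where d: "d > 0"
      "\<And>x y. x \<in> {-1..T} \<Longrightarrow> y \<in> {-1..T} \<Longrightarrow> \<bar>x - y\<bar> < d \<Longrightarrow> \<bar>z x - z y\<bar> < e / (K + 1)"
      using e K unfolding uniformly_continuous_on_def dist_real_def
      by (metis divide_pos_pos add_nonneg_pos zero_less_one)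
    obtain N where N: "1 / real (Suc N) < d"
      using d(1) reals_Archimedean by (metis inverse_eq_divide)
    have "norm (sampled n (step n \<tau>) \<tau> - delay_term \<mu> z \<tau>) < e" if "N \<le> n" for n
    proof -
      define p where "p = grid n (step n \<tau>)"
      have "of_int (step n \<tau>) \<le> real (Suc n) * \<tau>" "real (Suc n) * \<tau> < of_int (step n \<tau>) + 1"
        unfolding step_def by linarith+
      then have "p \<le> \<tau>" "\<tau> < (of_int (step n \<tau>) + 1) / real (Suc n)"
        unfolding p_def grid_def
        by (simp_all add: pos_divide_le_eq pos_less_divide_eq mult.commute del: of_nat_Suc)
      then have "p \<le> \<tau>" "\<tau> - p < 1 / real (Suc n)"
        unfolding p_def grid_def add_divide_distrib by linarith+
      moreover have "0 \<le> p"
        using \<tau> unfolding p_def grid_def step_def by simp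
      moreover have "1 / real (Suc n) \<le> 1 / real (Suc N)"
        using that by (simp add: frac_le)
      ultimately have p: "p \<in> {0..T}" "p \<le> \<tau>" "\<tau> - p < d" using N \<tau> by auto
      have cont: "continuous_on {-1..0} (\<lambda>s. z (p + s))" "continuous_on {-1..0} (\<lambda>s. z (\<tau> + s))"
        using continuous_on_segment[OF z] p(1) \<tau> by auto
      have \<mu>\<tau>: "\<mu> \<tau> \<in> delay_measures K" using \<mu> \<tau> by (auto simp: delay_measure_maps_def)
      have "sampled n (step n \<tau>) \<tau> - delay_term \<mu> z \<tau>
          = signed_integral delay_borel (\<mu> \<tau>) (\<lambda>s. z (p + s) - z (\<tau> + s))"
        using p(1) signed_integral_diff[OF \<mu>\<tau> K cont]
        by (simp add: sampled_def delay_term_def flip: p_def)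
      also have "\<bar>\<dots>\<bar> \<le> K * (e / (K + 1))"
      proof (rule abs_signed_integral_le[OF \<mu>\<tau> K])
        show "\<bar>z (p + s) - z (\<tau> + s)\<bar> \<le> e / (K + 1)" if "s \<in> {-1..0}" for s
          using d(2)[of "p + s" "\<tau> + s"] p \<tau> that by auto
      qed (intro continuous_on_diff cont)
      also have "\<dots> < e" using e K by (simp add: field_simps)
      finally show ?thesis by simp
    qed
    then show "\<exists>N. \<forall>n\<ge>N. norm (sampled n (step n \<tau>) \<tau> - delay_term \<mu> z \<tau>) < e" by blast
  qed
  show ?thesis
    using borel_measurable_LIMSEQ_real[OF _ meas] lim by (simp add: space_restrict_space)
qed

lemma set_integrable_bounded_lebesgue:
  fixes f :: "real \<Rightarrow> real"
  assumes "f \<in> borel_measurable (lebesgue_on {a..b})" "\<And>x. x \<in> {a..b} \<Longrightarrow> \<bar>f x\<bar> \<le> C"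
    and "{c..d} \<subseteq> {a..b}"
  shows "set_integrable lebesgue {c..d} f"
proof -
  have "set_integrable lebesgue {a..b} (\<lambda>_. C)"
    unfolding set_integrable_def
    by (intro integrable_scaleR_left integrable_real_indicator) (simp_all add: emeasure_lborel_Icc_eq)
  moreover have "set_borel_measurable lebesgue {a..b} f"
    using assms(1) unfolding set_borel_measurable_def by (subst (asm) borel_measurable_restrict_space_iff) auto
  ultimately have "set_integrable lebesgue {a..b} f"
    by (rule set_integrable_bound) (use assms(2) in force)
  then show ?thesis by (rule set_integrable_subset[OF _ _ assms(3)]) simp
qed

section \<open>Integration of the delay term and an exponentially weighted bound\<close>

lemma indefinite_set_integral_lipschitz:
  fixes f :: "real \<Rightarrow> real"
  assumes "f \<in> borel_measurable (lebesgue_on {0..T})" "\<And>x. x \<in> {0..T} \<Longrightarrow> \<bar>f x\<bar> \<le> C"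
    and "0 \<le> a" "a \<le> b" "b \<le> T"
  shows "\<bar>(LINT x:{0..b}|lebesgue. f x) - (LINT x:{0..a}|lebesgue. f x)\<bar> \<le> C * (b - a)"
proof -
  have int: "set_integrable lebesgue {c..d} f" if "0 \<le> c" "d \<le> T" for c d
    using assms(1,2) by (rule set_integrable_bounded_lebesgue) (use that in auto)
  have int': "set_integrable lebesgue {a<..b} f"
    using int[of a b] assms by (rule_tac set_integrable_subset[of _ "{a..b}"]) auto
  have split_int: "{0..b} = {0..a} \<union> {a<..b}" using assms by auto
  have "(LINT x:{0..b}|lebesgue. f x) = (LINT x:{0..a}|lebesgue. f x) + (LINT x:{a<..b}|lebesgue. f x)"
    unfolding split_int using assms int' by (intro set_integral_Un int) auto
  then have "\<bar>(LINT x:{0..b}|lebesgue. f x) - (LINT x:{0..a}|lebesgue. f x)\<bar>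
      = \<bar>LINT x:{a<..b}|lebesgue. f x\<bar>" by simp
  also have "\<dots> \<le> (LINT x:{a<..b}|lebesgue. \<bar>f x\<bar>)"
    using set_integral_norm_bound[OF int'] by simp
  also have "\<dots> \<le> (LINT x:{a<..b}|lebesgue. C)"
  proof (rule set_integral_mono)
    show "set_integrable lebesgue {a<..b} (\<lambda>x. \<bar>f x\<bar>)" using int' by (rule set_integrable_abs)
    show "set_integrable lebesgue {a<..b} (\<lambda>x. C)"
      unfolding set_integrable_def
      using assms(4) by (intro integrable_scaleR_left integrable_real_indicator) simp_all
  qed (use assms in auto)
  also have "\<dots> = C * (b - a)"
    using assms(4) by (simp add: set_lebesgue_integral_def measure_completion)
  finally show ?thesis .
qed

lemma continuous_on_indefinite_set_integral:
  fixes f :: "real \<Rightarrow> real"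
  assumes f: "f \<in> borel_measurable (lebesgue_on {0..T})" "\<And>x. x \<in> {0..T} \<Longrightarrow> \<bar>f x\<bar> \<le> C"
  shows "continuous_on {0..T} (\<lambda>t. LINT x:{0..t}|lebesgue. f x)"
proof (cases "0 \<le> T")
  case True
  then have "0 \<le> C" using f(2)[of 0] by auto
  have "C-lipschitz_on {0..T} (\<lambda>t. LINT x:{0..t}|lebesgue. f x)"
    using indefinite_set_integral_lipschitz[OF f] \<open>0 \<le> C\<close>
    by (intro lipschitz_on_leI) (auto simp: dist_real_def abs_minus_commute)
  then show ?thesis by (rule lipschitz_on_continuous_on)
qed simp

lemma set_integral_exp:
  fixes c t :: real
  assumes "0 < c" "0 \<le> t"
  shows "set_integrable lebesgue {0..t} (\<lambda>x. c * exp (c * x))"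
    and "(LINT x:{0..t}|lebesgue. c * exp (c * x)) = exp (c * t) - 1"
proof -
  have cont: "continuous_on {0..t} (\<lambda>x. c * exp (c * x))" by (intro continuous_intros)
  have "set_integrable lborel {0..t} (\<lambda>x. c * exp (c * x))"
    by (rule borel_integrable_atLeastAtMost') (rule cont)
  then show "set_integrable lebesgue {0..t} (\<lambda>x. c * exp (c * x))"
    unfolding set_integrable_def by (subst integrable_completion) simp_all
  have "(LINT x:{0..t}|lborel. c * exp (c * x)) = exp (c * t) - exp (c * 0)"
    unfolding set_lebesgue_integral_def
    by (rule integral_FTC_atLeastAtMost[OF assms(2) _ cont])
       (auto intro!: derivative_eq_intros simp flip: has_real_derivative_iff_has_vector_derivative)
  moreover have "(LINT x:{0..t}|lebesgue. c * exp (c * x)) = (LINT x:{0..t}|lborel. c * exp (c * x))"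
    unfolding set_lebesgue_integral_def by (rule integral_completion) simp
  ultimately show "(LINT x:{0..t}|lebesgue. c * exp (c * x)) = exp (c * t) - 1" by simp
qed

lemma delay_term_bounded:
  assumes "\<mu> \<in> delay_measure_maps K T" "0 \<le> K" "continuous_on {-1..T} z"
  shows "\<exists>C. \<forall>\<tau>\<in>{0..T}. \<bar>delay_term \<mu> z \<tau>\<bar> \<le> C"
proof -
  obtain C where C: "\<And>x. x \<in> {-1..T} \<Longrightarrow> \<bar>z x\<bar> \<le> C"
    using continuous_on_Icc_abs_bounded[OF assms(3)] by blast
  have "\<bar>delay_term \<mu> z \<tau>\<bar> \<le> K * C" if "\<tau> \<in> {0..T}" for \<tau>
    using that by (intro abs_delay_term_le[OF assms(1,2) that assms(3)] C) auto
  then show ?thesis by blast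
qed

lemma set_integrable_delay_term:
  assumes "\<mu> \<in> delay_measure_maps K T" "0 \<le> K" "continuous_on {-1..T} z" "t \<le> T"
  shows "set_integrable lebesgue {0..t} (delay_term \<mu> z)"
proof -
  obtain C where C: "\<And>\<tau>. \<tau> \<in> {0..T} \<Longrightarrow> \<bar>delay_term \<mu> z \<tau>\<bar> \<le> C"
    using delay_term_bounded[OF assms(1-3)] by blast
  show ?thesis
    by (rule set_integrable_bounded_lebesgue[OF borel_measurable_delay_term[OF assms(1-3)] C])
       (use assms(4) in auto)
qed

text \<open>The segment at \<open>\<tau>\<close> lies to the left of \<open>\<tau>\<close>, where the increasing weight \<open>exp (2 K x)\<close> is at most
  \<open>exp (2 K \<tau>)\<close>. Integrating \<open>K exp (2 K \<tau>)\<close> then gains the factor \<open>1/2\<close>, the reason for the exponent \<open>2 K\<close>.\<close>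

lemma abs_integral_delay_term_le_weighted:
  assumes \<mu>: "\<mu> \<in> delay_measure_maps K T" and K: "0 < K" and w: "continuous_on {-1..T} w"
    and M: "\<And>x. x \<in> {-1..T} \<Longrightarrow> \<bar>w x\<bar> \<le> M * exp (2 * K * x)" and t: "t \<in> {0..T}"
  shows "\<bar>LINT \<tau>:{0..t}|lebesgue. delay_term \<mu> w \<tau>\<bar> \<le> M / 2 * exp (2 * K * t)"
proof -
  have "0 \<le> M" using M[of 0] t by simp
  have int: "set_integrable lebesgue {0..t} (delay_term \<mu> w)"
    using \<mu> K w t by (intro set_integrable_delay_term) auto
  have "\<bar>LINT \<tau>:{0..t}|lebesgue. delay_term \<mu> w \<tau>\<bar>
      \<le> (LINT \<tau>:{0..t}|lebesgue. \<bar>delay_term \<mu> w \<tau>\<bar>)"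
    using set_integral_norm_bound[OF int] by simp
  also have "\<dots> \<le> (LINT \<tau>:{0..t}|lebesgue. M / 2 * (2 * K * exp (2 * K * \<tau>)))"
  proof (rule set_integral_mono)
    show "set_integrable lebesgue {0..t} (\<lambda>\<tau>. \<bar>delay_term \<mu> w \<tau>\<bar>)"
      using int by (rule set_integrable_abs)
    show "set_integrable lebesgue {0..t} (\<lambda>\<tau>. M / 2 * (2 * K * exp (2 * K * \<tau>)))"
      using set_integral_exp(1)[of "2 * K" t] K t by (intro set_integrable_mult_right) auto
    show "\<bar>delay_term \<mu> w \<tau>\<bar> \<le> M / 2 * (2 * K * exp (2 * K * \<tau>))" if "\<tau> \<in> {0..t}" for \<tau>
    proof -
      have "\<bar>delay_term \<mu> w \<tau>\<bar> \<le> K * (M * exp (2 * K * \<tau>))"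
      proof (rule abs_delay_term_le[OF \<mu> _ _ w])
        show "\<bar>w x\<bar> \<le> M * exp (2 * K * \<tau>)" if "x \<in> {\<tau> - 1..\<tau>}" for x
        proof -
          have "\<bar>w x\<bar> \<le> M * exp (2 * K * x)"
            using M that \<open>\<tau> \<in> {0..t}\<close> t by auto
          also have "\<dots> \<le> M * exp (2 * K * \<tau>)"
            using that K \<open>0 \<le> M\<close> by (intro mult_left_mono) auto
          finally show ?thesis .
        qed
      qed (use that t K in auto)
      then show ?thesis by (simp add: algebra_simps)
    qed
  qed
  also have "\<dots> = M / 2 * (exp (2 * K * t) - 1)"
    using set_integral_exp(2)[of "2 * K" t] K t by (subst set_integral_mult_right) simp_all
  also have "\<dots> \<le> M / 2 * exp (2 * K * t)" using \<open>0 \<le> M\<close> by (intro mult_left_mono) auto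
  finally show ?thesis .
qed

text \<open>Take a point \<open>x\<close> where \<open>q x = \<bar>w x\<bar> exp (- 2 K x)\<close> is maximal. If \<open>x \<le> 0\<close>, then
  \<open>q x = 0\<close>; otherwise the weighted bound turns the hypothesis at \<open>x\<close> into \<open>q x \<le> \<epsilon> + q x / 2\<close>, and the second term is absorbed.\<close>

lemma delay_gronwall:
  assumes \<mu>: "\<mu> \<in> delay_measure_maps K T" and K: "0 < K" and T: "0 < T"
    and w: "continuous_on {-1..T} w" "\<And>t. t \<in> {-1..0} \<Longrightarrow> w t = 0"
    and le: "\<And>t. t \<in> {0..T} \<Longrightarrow> \<bar>w t\<bar> \<le> \<epsilon> + \<bar>LINT \<tau>:{0..t}|lebesgue. delay_term \<mu> w \<tau>\<bar>"
    and "0 \<le> \<epsilon>" and t: "t \<in> {-1..T}"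
  shows "\<bar>w t\<bar> \<le> 2 * \<epsilon> * exp (2 * K * T)"
proof -
  define q where "q x = \<bar>w x\<bar> * exp (- (2 * K * x))" for x
  have "continuous_on {-1..T} q"
    unfolding q_def[abs_def] by (intro continuous_intros w(1))
  moreover have "{-1..T} \<noteq> {}" using T by auto
  ultimately obtain x where x: "x \<in> {-1..T}" "\<And>y. y \<in> {-1..T} \<Longrightarrow> q y \<le> q x"
    using continuous_attains_sup[OF compact_Icc, of "-1" T q] by blast
  have w_eq: "\<bar>w y\<bar> = q y * exp (2 * K * y)" for y
    by (simp add: q_def exp_minus field_simps)
  have w_le: "\<bar>w y\<bar> \<le> q x * exp (2 * K * y)" if "y \<in> {-1..T}" for y
    unfolding w_eq using x(2)[OF that] by (intro mult_right_mono) auto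
  have "0 \<le> q x" by (simp add: q_def)
  have "q x \<le> 2 * \<epsilon>"
  proof (cases "x \<le> 0")
    case True
    then show ?thesis using w(2)[of x] x(1) \<open>0 \<le> \<epsilon>\<close> by (simp add: q_def)
  next
    case False
    then have x': "x \<in> {0..T}" using x(1) by auto
    have "\<bar>w x\<bar> \<le> \<epsilon> + q x / 2 * exp (2 * K * x)"
      using le[OF x'] abs_integral_delay_term_le_weighted[OF \<mu> K w(1) w_le x'] by linarith
    also have "\<epsilon> \<le> \<epsilon> * exp (2 * K * x)"
      using mult_left_mono[of 1 "exp (2 * K * x)" \<epsilon>] \<open>0 \<le> \<epsilon>\<close> K x' by simp
    finally have "q x * exp (2 * K * x) \<le> (\<epsilon> + q x / 2) * exp (2 * K * x)"
      unfolding w_eq by (simp add: algebra_simps)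
    then have "q x \<le> \<epsilon> + q x / 2" by simp
    then show ?thesis by simp
  qed
  have "\<bar>w t\<bar> \<le> q x * exp (2 * K * t)" using w_le[OF t] .
  also have "\<dots> \<le> 2 * \<epsilon> * exp (2 * K * T)"
    using \<open>q x \<le> 2 * \<epsilon>\<close> \<open>0 \<le> \<epsilon>\<close> t K by (intro mult_mono) auto
  finally show ?thesis .
qed

section \<open>Existence and uniqueness of solutions\<close>

text \<open>The right-hand side of the delay equation, written with \<open>min\<close> and \<open>max\<close> so that one formula covers
  the initial interval and \<open>[0,T]\<close>; at \<open>t \<le> 0\<close> the integral runs over a single point.\<close>

definition picard ::
    "(real \<Rightarrow> real) \<Rightarrow> (real \<Rightarrow> real set \<Rightarrow> real) \<Rightarrow> (real \<Rightarrow> real) \<Rightarrow> real \<Rightarrow> real" where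
  "picard u\<^sub>0 \<mu> z t = u\<^sub>0 (min t 0) + (LINT \<tau>:{0..max t 0}|lebesgue. delay_term \<mu> z \<tau>)"

lemma set_integral_point_lebesgue:
  fixes f :: "real \<Rightarrow> real"
  shows "(LINT x:{a..a}|lebesgue. f x) = 0"
proof -
  have "{a} \<in> null_sets lebesgue" by (intro null_sets_completionI finite_imp_null_set_lborel) simp
  then have "AE x in lebesgue. x \<notin> {a}" by (rule AE_not_in)
  then have "AE x in lebesgue. indicat_real {a..a} x *\<^sub>R f x = 0"
    by eventually_elim simp
  then show ?thesis unfolding set_lebesgue_integral_def by (rule integral_eq_zero_AE)
qed

lemma is_delay_solution_iff_picard:
  assumes "0 \<le> T"
  shows "is_delay_solution T \<mu> u\<^sub>0 z \<longleftrightarrow>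
           continuous_on {-1..T} z \<and> (\<forall>t\<in>{-1..T}. z t = picard u\<^sub>0 \<mu> z t)"
proof -
  have "picard u\<^sub>0 \<mu> z t = u\<^sub>0 t" if "t \<le> 0" for t
    using that by (simp add: picard_def max_def min_def set_integral_point_lebesgue del: atLeastAtMost_singleton)
  moreover have "picard u\<^sub>0 \<mu> z t = u\<^sub>0 0 + (LINT \<tau>:{0..t}|lebesgue. delay_term \<mu> z \<tau>)" if "0 \<le> t" for t
    using that by (simp add: picard_def max_def min_def)
  moreover have "{-1..T} = {-1..0} \<union> {0..T}" using assms by auto
  ultimately show ?thesis
    unfolding is_delay_solution_def delay_term_def by (simp add: ball_Un)
qed

lemma picard_cong:
  assumes "\<And>x. x \<in> {-1..T} \<Longrightarrow> z x = w x" "t \<in> {-1..T}" "0 \<le> T"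
  shows "picard u\<^sub>0 \<mu> z t = picard u\<^sub>0 \<mu> w t"
proof -
  have "delay_term \<mu> z \<tau> = delay_term \<mu> w \<tau>" if "\<tau> \<in> {0..T}" for \<tau>
    unfolding delay_term_def using that by (intro signed_integral_cong assms(1)) auto
  then have "(LINT \<tau>:{0..max t 0}|lebesgue. delay_term \<mu> z \<tau>)
      = (LINT \<tau>:{0..max t 0}|lebesgue. delay_term \<mu> w \<tau>)"
    using assms(2,3) by (intro set_lebesgue_integral_cong) auto
  then show ?thesis by (simp add: picard_def)
qed

lemma continuous_on_picard:
  assumes u: "continuous_on {-1..0} u\<^sub>0" and "\<mu> \<in> delay_measure_maps K T" "0 \<le> K" "0 \<le> T"
    "continuous_on {-1..T} z"
  shows "continuous_on {-1..T} (picard u\<^sub>0 \<mu> z)"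
proof -
  obtain C where "\<And>\<tau>. \<tau> \<in> {0..T} \<Longrightarrow> \<bar>delay_term \<mu> z \<tau>\<bar> \<le> C"
    using delay_term_bounded[OF assms(2,3,5)] by blast
  then have "continuous_on {0..T} (\<lambda>t. LINT \<tau>:{0..t}|lebesgue. delay_term \<mu> z \<tau>)"
    by (rule continuous_on_indefinite_set_integral[OF borel_measurable_delay_term[OF assms(2,3,5)]])
  then have "continuous_on {-1..T} (\<lambda>t. LINT \<tau>:{0..max t 0}|lebesgue. delay_term \<mu> z \<tau>)"
    by (rule continuous_on_compose2) (use assms(4) in \<open>auto intro!: continuous_intros\<close>)
  moreover have "continuous_on {-1..T} (\<lambda>t. u\<^sub>0 (min t 0))"
    by (rule continuous_on_compose2[OF u]) (auto intro!: continuous_intros)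
  ultimately show ?thesis unfolding picard_def[abs_def] by (intro continuous_on_add)
qed

lemma picard_diff:
  assumes \<mu>: "\<mu> \<in> delay_measure_maps K T" and "0 \<le> K" "0 \<le> T"
    and zw: "continuous_on {-1..T} z" "continuous_on {-1..T} w" and t: "t \<in> {-1..T}"
  shows "picard u\<^sub>0 \<mu> z t - picard u\<^sub>0 \<mu> w t
           = (LINT \<tau>:{0..max t 0}|lebesgue. delay_term \<mu> (\<lambda>x. z x - w x) \<tau>)"
proof -
  have "(LINT \<tau>:{0..max t 0}|lebesgue. delay_term \<mu> (\<lambda>x. z x - w x) \<tau>)
      = (LINT \<tau>:{0..max t 0}|lebesgue. delay_term \<mu> z \<tau> - delay_term \<mu> w \<tau>)"
    using assms by (intro set_lebesgue_integral_cong allI impI delay_term_diff) auto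
  also have "\<dots> = (LINT \<tau>:{0..max t 0}|lebesgue. delay_term \<mu> z \<tau>)
      - (LINT \<tau>:{0..max t 0}|lebesgue. delay_term \<mu> w \<tau>)"
    using assms by (intro set_integral_diff set_integrable_delay_term) auto
  finally show ?thesis by (simp add: picard_def)
qed

lemma picard_contraction_weighted:
  assumes \<mu>: "\<mu> \<in> delay_measure_maps K T" and K: "0 < K" and T: "0 \<le> T"
    and zw: "continuous_on {-1..T} z" "continuous_on {-1..T} w"
    and M: "\<And>x. x \<in> {-1..T} \<Longrightarrow> \<bar>z x - w x\<bar> \<le> M * exp (2 * K * x)"
    and t: "t \<in> {-1..T}"
  shows "\<bar>picard u\<^sub>0 \<mu> z t - picard u\<^sub>0 \<mu> w t\<bar> \<le> M / 2 * exp (2 * K * t)"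
proof (cases "t \<le> 0")
  case True
  have "0 \<le> M" using M[of 0] T by simp
  have "picard u\<^sub>0 \<mu> z t - picard u\<^sub>0 \<mu> w t = 0"
    using True by (simp add: picard_def max_def set_integral_point_lebesgue del: atLeastAtMost_singleton)
  then show ?thesis using \<open>0 \<le> M\<close> by simp
next
  case False
  have "\<bar>LINT \<tau>:{0..t}|lebesgue. delay_term \<mu> (\<lambda>x. z x - w x) \<tau>\<bar> \<le> M / 2 * exp (2 * K * t)"
    using False t
    by (intro abs_integral_delay_term_le_weighted[OF \<mu> K _ M] continuous_on_diff zw) auto
  then show ?thesis
    using False picard_diff[OF \<mu> _ T zw t, of u\<^sub>0] K by (simp add: max_def)
qed

text \<open>Banach's fixed point theorem in the space of bounded continuous functions. The weight is put into
  the functions: the substitution \<open>z x = exp (2 K x) y x\<close> turns the weighted sup norm of \<open>z\<close> into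
  the ordinary sup norm of \<open>y\<close>, for which the transformed Picard operator has Lipschitz constant
  \<open>1/2\<close>. Clamping the argument extends functions on \<open>[-1,T]\<close> to the whole line.\<close>

lemma delay_solution_exists:
  assumes u: "continuous_on {-1..0} u\<^sub>0" and \<mu>: "\<mu> \<in> delay_measure_maps K T"
    and K: "0 < K" and T: "0 < T"
  shows "\<exists>z. is_delay_solution T \<mu> u\<^sub>0 z"
proof -
  define lift where "lift y x = exp (2 * K * x) * apply_bcontfun y x"
    for y :: "real \<Rightarrow>\<^sub>C real" and x
  define g where "g y t = exp (- (2 * K * t)) * picard u\<^sub>0 \<mu> (lift y) t" for y t
  define \<Phi> where "\<Phi> y = Bcontfun (\<lambda>t. g y (clamp (-1) T t))" for y
  have lift: "continuous_on {-1..T} (lift y)" for y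
    unfolding lift_def[abs_def] by (intro continuous_intros continuous_on_apply_bcontfun)
  have g: "continuous_on (cbox (-1) T) (g y)" for y
    unfolding g_def[abs_def] using K T
    by (auto intro!: continuous_intros continuous_on_picard[OF u \<mu>] lift)
  have "bounded (g y ` cbox (-1) T)" for y
    using compact_continuous_image[OF g compact_cbox] by (rule compact_imp_bounded)
  then have "(\<lambda>t. g y (clamp (-1) T t)) \<in> bcontfun" for y
    unfolding bcontfun_def using clamp_continuous_on[OF g] clamp_bounded by blast
  then have \<Phi>: "apply_bcontfun (\<Phi> y) t = g y (clamp (-1) T t)" for y t
    unfolding \<Phi>_def by (subst Bcontfun_inverse) auto
  have "dist (\<Phi> y) (\<Phi> y') \<le> 1/2 * dist y y'" for y y'
  proof (rule dist_bound)
    fix t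
    define c where "c = clamp (-1) T t"
    have c: "c \<in> {-1..T}" unfolding c_def using T clamp_in_interval[of "-1" T t] by simp
    have "\<bar>lift y x - lift y' x\<bar> \<le> dist y y' * exp (2 * K * x)" for x
    proof -
      have "lift y x - lift y' x = (y x - y' x) * exp (2 * K * x)"
        by (simp add: lift_def algebra_simps)
      then show ?thesis
        using dist_bounded[of y x y'] by (simp add: dist_real_def abs_mult)
    qed
    then have "\<bar>picard u\<^sub>0 \<mu> (lift y) c - picard u\<^sub>0 \<mu> (lift y') c\<bar> \<le> dist y y' / 2 * exp (2 * K * c)"
      using T by (intro picard_contraction_weighted[OF \<mu> K _ lift lift _ c]) auto
    then have "exp (- (2 * K * c)) * \<bar>picard u\<^sub>0 \<mu> (lift y) c - picard u\<^sub>0 \<mu> (lift y') c\<bar>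
        \<le> exp (- (2 * K * c)) * (dist y y' / 2 * exp (2 * K * c))"
      by (intro mult_left_mono) auto
    also have "\<dots> = 1/2 * dist y y'" by (simp add: exp_minus)
    finally show "dist (\<Phi> y t) (\<Phi> y' t) \<le> 1/2 * dist y y'"
      by (simp add: \<Phi> dist_real_def g_def abs_mult flip: c_def right_diff_distrib)
  qed
  then have "\<exists>!y. \<Phi> y = y" by (intro banach_fix_type[of "1/2"]) auto
  then obtain y where y: "\<Phi> y = y" by blast
  have "lift y t = picard u\<^sub>0 \<mu> (lift y) t" if "t \<in> {-1..T}" for t
  proof -
    have "apply_bcontfun y t = g y t" using \<Phi>[of y t] that by (simp add: y)
    then show ?thesis by (simp add: lift_def[of y t] g_def exp_minus)
  qed
  then have "is_delay_solution T \<mu> u\<^sub>0 (lift y)"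
    using lift T by (simp add: is_delay_solution_iff_picard)
  then show ?thesis by blast
qed

lemma delay_solution_unique:
  assumes \<mu>: "\<mu> \<in> delay_measure_maps K T" and K: "0 < K" and T: "0 < T"
    and z: "is_delay_solution T \<mu> u\<^sub>0 z" and w: "is_delay_solution T \<mu> u\<^sub>0 w" and t: "t \<in> {-1..T}"
  shows "z t = w t"
proof -
  have cont: "continuous_on {-1..T} z" "continuous_on {-1..T} w"
    using z w by (auto simp: is_delay_solution_def)
  have "\<bar>z t - w t\<bar> \<le> 2 * 0 * exp (2 * K * T)"
  proof (rule delay_gronwall[OF \<mu> K T _ _ _ _ t])
    show "continuous_on {-1..T} (\<lambda>x. z x - w x)" by (intro continuous_on_diff cont)
    show "z t - w t = 0" if "t \<in> {-1..0}" for t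
      using that z w by (auto simp: is_delay_solution_def)
    show "\<bar>z t - w t\<bar> \<le> 0 + \<bar>LINT \<tau>:{0..t}|lebesgue. delay_term \<mu> (\<lambda>x. z x - w x) \<tau>\<bar>"
      if "t \<in> {0..T}" for t
      using that z w T K picard_diff[OF \<mu> _ _ cont, of t u\<^sub>0]
      by (auto simp: is_delay_solution_iff_picard max_def)
  qed simp
  then show ?thesis by simp
qed

text \<open>Restricting a solution to \<open>[-1,T]\<close> makes it \<open>undefined\<close> elsewhere; it remains a solution because
  the equation evaluates its argument only on \<open>[-1,T]\<close>.\<close>

lemma is_delay_solution_delay_solution:
  assumes u: "continuous_on {-1..0} u\<^sub>0" and \<mu>: "\<mu> \<in> delay_measure_maps K T"
    and K: "0 < K" and T: "0 < T"
  shows "is_delay_solution T \<mu> u\<^sub>0 (delay_solution T \<mu> u\<^sub>0)"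
proof -
  obtain z where z: "is_delay_solution T \<mu> u\<^sub>0 z"
    using delay_solution_exists[OF assms] by blast
  let ?z = "restrict z {-1..T}"
  have "continuous_on {-1..T} ?z"
    using z continuous_on_cong[of "{-1..T}" "{-1..T}" z ?z] by (simp add: is_delay_solution_def)
  moreover have "?z t = picard u\<^sub>0 \<mu> ?z t" if "t \<in> {-1..T}" for t
    using z T that picard_cong[of T ?z z t u\<^sub>0 \<mu>] by (simp add: is_delay_solution_iff_picard)
  ultimately have z': "is_delay_solution T \<mu> u\<^sub>0 ?z"
    using T by (simp add: is_delay_solution_iff_picard)
  have "\<exists>!z. z \<in> extensional {-1..T} \<and> is_delay_solution T \<mu> u\<^sub>0 z"
  proof (rule ex1I[of _ ?z])
    fix w assume w: "w \<in> extensional {-1..T} \<and> is_delay_solution T \<mu> u\<^sub>0 w"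
    then show "w = ?z"
      using delay_solution_unique[OF \<mu> K T _ z']
      by (intro extensionalityI[of w "{-1..T}"]) auto
  qed (use z' in simp)
  from theI'[OF this] show ?thesis unfolding delay_solution_def by (rule conjunct2)
qed


section \<open>Continuous dependence on the measures\<close>

text \<open>The exceptional null set is common to all test functions, so it is permissible to use at each time
  \<open>\<tau>\<close> a different one, the segment of \<open>z\<close> at \<open>\<tau>\<close>.\<close>

lemma delay_term_L1_convergence:
  assumes K: "0 \<le> K" and \<mu>n: "\<And>n. \<mu>n n \<in> delay_measure_maps K T"
    and \<mu>: "\<mu> \<in> delay_measure_maps K T"
    and lim: "converges_weak_star_ae T \<mu>n \<mu>" and z: "continuous_on {-1..T} z"
  shows "(\<lambda>n. LINT \<tau>:{0..T}|lebesgue. \<bar>delay_term (\<mu>n n) z \<tau> - delay_term \<mu> z \<tau>\<bar>) \<longlonglongrightarrow> 0"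
proof -
  let ?L = "lebesgue_on {0..T}"
  let ?d = "\<lambda>n \<tau>. \<bar>delay_term (\<mu>n n) z \<tau> - delay_term \<mu> z \<tau>\<bar>"
  obtain C where C: "\<And>x. x \<in> {-1..T} \<Longrightarrow> \<bar>z x\<bar> \<le> C"
    using continuous_on_Icc_abs_bounded[OF z] by blast
  have "(\<lambda>n. integral\<^sup>L ?L (?d n)) \<longlonglongrightarrow> integral\<^sup>L ?L (\<lambda>_. 0)"
  proof (rule integral_dominated_convergence)
    show "integrable ?L (\<lambda>_. K * C + K * C)"
      by (simp add: emeasure_restrict_space)
    show "?d n \<in> borel_measurable ?L" for n
      using \<mu>n \<mu> K z by (intro borel_measurable_abs borel_measurable_diff borel_measurable_delay_term)
    show "AE \<tau> in ?L. (\<lambda>n. ?d n \<tau>) \<longlonglongrightarrow> 0"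
      using lim unfolding converges_weak_star_ae_def
    proof (rule AE_mp[OF _ AE_I2], intro impI)
      fix \<tau> assume \<tau>: "\<tau> \<in> space ?L"
        and *: "\<forall>f. continuous_on {-1..0} f \<longrightarrow> (\<lambda>n. signed_integral delay_borel (\<mu>n n \<tau>) f)
                  \<longlonglongrightarrow> signed_integral delay_borel (\<mu> \<tau>) f"
      have "(\<lambda>n. delay_term (\<mu>n n) z \<tau>) \<longlonglongrightarrow> delay_term \<mu> z \<tau>"
        unfolding delay_term_def using * \<tau> continuous_on_segment[OF z, of \<tau>]
        by (simp add: space_restrict_space)
      then show "(\<lambda>n. ?d n \<tau>) \<longlonglongrightarrow> 0"
        by (metis LIM_zero tendsto_rabs_zero)
    qed
    show "AE \<tau> in ?L. norm (?d n \<tau>) \<le> K * C + K * C" for n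
    proof (rule AE_I2)
      fix \<tau> assume "\<tau> \<in> space ?L"
      then have \<tau>: "\<tau> \<in> {0..T}" by (simp add: space_restrict_space)
      have "\<bar>delay_term \<kappa> z \<tau>\<bar> \<le> K * C" if "\<kappa> \<in> delay_measure_maps K T" for \<kappa>
        using \<tau> by (intro abs_delay_term_le[OF that K \<tau> z] C) auto
      from this[OF \<mu>n[of n]] this[OF \<mu>] show "norm (?d n \<tau>) \<le> K * C + K * C"
        unfolding real_norm_def by linarith
    qed
  qed simp
  then show ?thesis
    by (simp add: integral_restrict_space set_lebesgue_integral_def)
qed

text \<open>Splitting at the Picard operator of \<open>\<nu>\<close> applied to \<open>z\<close> leaves a term that is linear in \<open>w - z\<close> and
  one in which only the measures differ.\<close>

lemma delay_solution_stability:
  assumes K: "0 < K" and T: "0 < T"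
    and \<mu>: "\<mu> \<in> delay_measure_maps K T" and \<nu>: "\<nu> \<in> delay_measure_maps K T"
    and z: "is_delay_solution T \<mu> u\<^sub>0 z" and w: "is_delay_solution T \<nu> u\<^sub>0 w" and t: "t \<in> {-1..T}"
  shows "\<bar>w t - z t\<bar>
    \<le> 2 * (LINT \<tau>:{0..T}|lebesgue. \<bar>delay_term \<nu> z \<tau> - delay_term \<mu> z \<tau>\<bar>) * exp (2 * K * T)"
proof (rule delay_gronwall[OF \<nu> K T _ _ _ _ t])
  let ?d = "\<lambda>\<tau>. delay_term \<nu> z \<tau> - delay_term \<mu> z \<tau>"
  let ?\<epsilon> = "LINT \<tau>:{0..T}|lebesgue. \<bar>?d \<tau>\<bar>"
  have cont: "continuous_on {-1..T} w" "continuous_on {-1..T} z"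
    using z w by (auto simp: is_delay_solution_def)
  note int = set_integrable_delay_term[OF _ less_imp_le[OF K]]
  show "continuous_on {-1..T} (\<lambda>x. w x - z x)" by (intro continuous_on_diff cont)
  show "w t - z t = 0" if "t \<in> {-1..0}" for t
    using that z w by (auto simp: is_delay_solution_def)
  show "0 \<le> ?\<epsilon>" unfolding set_lebesgue_integral_def by (intro integral_nonneg_AE AE_I2) simp
  show "\<bar>w t - z t\<bar> \<le> ?\<epsilon> + \<bar>LINT \<tau>:{0..t}|lebesgue. delay_term \<nu> (\<lambda>x. w x - z x) \<tau>\<bar>"
    if t: "t \<in> {0..T}" for t
  proof -
    have d: "set_integrable lebesgue {0..s} ?d" if "s \<le> T" for s
      using \<mu> \<nu> cont that by (intro set_integral_diff int)
    have "w t - z t = (picard u\<^sub>0 \<nu> w t - picard u\<^sub>0 \<nu> z t) + (picard u\<^sub>0 \<nu> z t - picard u\<^sub>0 \<mu> z t)"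
      using z w t T by (simp add: is_delay_solution_iff_picard)
    also have "picard u\<^sub>0 \<nu> w t - picard u\<^sub>0 \<nu> z t
        = (LINT \<tau>:{0..t}|lebesgue. delay_term \<nu> (\<lambda>x. w x - z x) \<tau>)"
      using picard_diff[OF \<nu> _ _ cont, of t u\<^sub>0] K T t by (simp add: max_absorb1)
    also have "picard u\<^sub>0 \<nu> z t - picard u\<^sub>0 \<mu> z t = (LINT \<tau>:{0..t}|lebesgue. ?d \<tau>)"
      using set_integral_diff(2)[OF int[OF \<nu> cont(2)] int[OF \<mu> cont(2)], of t] t
      by (simp add: picard_def max_absorb1)
    finally have "w t - z t = (LINT \<tau>:{0..t}|lebesgue. delay_term \<nu> (\<lambda>x. w x - z x) \<tau>)
        + (LINT \<tau>:{0..t}|lebesgue. ?d \<tau>)" .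
    moreover have "\<bar>LINT \<tau>:{0..t}|lebesgue. ?d \<tau>\<bar> \<le> (LINT \<tau>:{0..t}|lebesgue. \<bar>?d \<tau>\<bar>)"
      using set_integral_norm_bound[OF d, of t] t by simp
    moreover have "(LINT \<tau>:{0..t}|lebesgue. \<bar>?d \<tau>\<bar>) \<le> ?\<epsilon>"
      unfolding set_lebesgue_integral_def
    proof (rule integral_mono)
      have "set_integrable lebesgue {0..s} (\<lambda>\<tau>. \<bar>?d \<tau>\<bar>)" if "s \<le> T" for s
        using d[OF that] by (rule set_integrable_abs)
      then show "integrable lebesgue (\<lambda>\<tau>. indicat_real {0..t} \<tau> *\<^sub>R \<bar>?d \<tau>\<bar>)"
        "integrable lebesgue (\<lambda>\<tau>. indicat_real {0..T} \<tau> *\<^sub>R \<bar>?d \<tau>\<bar>)"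
        using t unfolding set_integrable_def by auto
    qed (use t in \<open>auto simp: indicator_def\<close>)
    ultimately show ?thesis by linarith
  qed
qed

lemma sup_norm_on_bounds:
  assumes "S \<noteq> {}" "\<And>x. x \<in> S \<Longrightarrow> \<bar>f x\<bar> \<le> B"
  shows "0 \<le> sup_norm_on S f" "sup_norm_on S f \<le> B"
proof -
  obtain x where x: "x \<in> S" using assms(1) by blast
  have "bdd_above ((\<lambda>x. \<bar>f x\<bar>) ` S)" using assms(2) by (intro bdd_aboveI2)
  then have "\<bar>f x\<bar> \<le> sup_norm_on S f" unfolding sup_norm_on_def by (rule cSUP_upper2[OF _ x]) simp
  then show "0 \<le> sup_norm_on S f" by linarith
  show "sup_norm_on S f \<le> B" unfolding sup_norm_on_def using assms by (rule cSUP_least)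
qed

theorem theorem3p1:
  fixes T K :: real
    and u\<^sub>0 :: "real \<Rightarrow> real"
    and \<mu>n :: "nat \<Rightarrow> real \<Rightarrow> real set \<Rightarrow> real"
    and \<mu> :: "real \<Rightarrow> real set \<Rightarrow> real"
  assumes "T > 0" and "K > 0"
    and "continuous_on {-1..0} u\<^sub>0"
    and "\<And>n. \<mu>n n \<in> delay_measure_maps K T"
    and "\<mu> \<in> delay_measure_maps K T"
    and "converges_weak_star_ae T \<mu>n \<mu>"
  shows "(\<lambda>n. sup_norm_on {-1..T}
            (\<lambda>t. delay_solution T (\<mu>n n) u\<^sub>0 t - delay_solution T \<mu> u\<^sub>0 t)) \<longlonglongrightarrow> 0"
proof -
  let ?z = "delay_solution T \<mu> u\<^sub>0" and ?zn = "\<lambda>n. delay_solution T (\<mu>n n) u\<^sub>0"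
  define \<epsilon> where
    "\<epsilon> n = (LINT \<tau>:{0..T}|lebesgue. \<bar>delay_term (\<mu>n n) ?z \<tau> - delay_term \<mu> ?z \<tau>\<bar>)" for n
  have z: "is_delay_solution T \<mu> u\<^sub>0 ?z" "is_delay_solution T (\<mu>n n) u\<^sub>0 (?zn n)" for n
    using assms by (auto intro: is_delay_solution_delay_solution)
  have bound: "\<bar>?zn n t - ?z t\<bar> \<le> 2 * \<epsilon> n * exp (2 * K * T)" if "t \<in> {-1..T}" for n t
    unfolding \<epsilon>_def
    by (rule delay_solution_stability[OF assms(2,1,5) assms(4) z that])
  have "\<epsilon> \<longlonglongrightarrow> 0"
    unfolding \<epsilon>_def[abs_def] using assms z(1)
    by (intro delay_term_L1_convergence[of K]) (auto simp: is_delay_solution_def)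
  then have "(\<lambda>n. 2 * \<epsilon> n * exp (2 * K * T)) \<longlonglongrightarrow> 2 * 0 * exp (2 * K * T)"
    by (intro tendsto_mult tendsto_const)
  then have lim: "(\<lambda>n. 2 * \<epsilon> n * exp (2 * K * T)) \<longlonglongrightarrow> 0" by simp
  have ne: "{-1..T} \<noteq> {}" using assms(1) by simp
  have lower: "0 \<le> sup_norm_on {-1..T} (\<lambda>t. ?zn n t - ?z t)" for n
    using ne bound[of _ n] by (rule sup_norm_on_bounds(1))
  have upper: "sup_norm_on {-1..T} (\<lambda>t. ?zn n t - ?z t) \<le> 2 * \<epsilon> n * exp (2 * K * T)" for n
    using ne bound[of _ n] by (rule sup_norm_on_bounds(2))
  show ?thesis
    by (rule tendsto_sandwich[OF _ _ tendsto_const lim]) (simp_all add: lower upper)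
qed

end
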